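(* Let $G=(V,E)$ be an infinite, locally finite, connected graph without loops or multiple edges. Suppose that there is a vertex $x_0\in V$ such that $M(r)=\max_{x\in S_r(x_0)} m(x)$ satisfies $$\sum_{r=0}^\infty \frac{1}{M(r)}=\infty .$$ Then $G$ is stochastically complete.
   Context: $m(x)$ is the valence (number of neighbors) of $x$; $d(x,y)$ is the number of edges in a shortest path from $x$ to $y$; $S_r(x_0)=\{x\in V: d(x,x_0)=r\}$. Laplacian: $\Delta f(x)=\sum_{y\sim x}(f(x)-f(y))$ for $f:V\to\mathbf{R}$. Heat kernel: fix a vertex $o\in V$. For $r\ge 0$ let $B_r$ be the subgraph induced on the vertices at distance at most $r$ from $o$; $\mathrm{int}\,B_r$ is the set of vertices of $B_r$ all of whose neighbors in $G$ lie in $B_r$, and $\partial B_r$ is the set of remaining vertices of $B_r$. Let $C(B_r,\partial B_r)$ be the finite-dimensional space of real functions on $B_r$ vanishing on $\partial B_r$, and let $\Delta_r$ act on it by $\Delta_r f(x)=\Delta f(x)$ for $x\in \mathrm{int}\,B_r$ and $\Delta_r f(x)=0$ for $x \in \partial B_r$. For $t\ge 0$ put $p_t^r(x,y)=e^{-t\Delta_r}\delta_x(y)$ for $x,y\in\mathrm{int}\,B_r$ and $p_t^r(x,y)=0$ for all other pairs of vertices. The heat kernel of $G$ is $p_t(x,y)=\lim_{r\to\infty}p_t^r(x,y)$ (the limit exists and does not depend on $o$). Equivalently, $p_t(x,y)$ is the smallest non-negative function satisfying $\Delta p_t(x,y)+\frac{\partial}{\partial t}p_t(x,y)=0$ for $t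 \geq 0$ and $p_0(x,y)=\delta_x(y)$. One has $\sum_{y\in V}p_t(x,y)\le 1$. $G$ is stochastically incomplete if $\sum_{y\in V}p_t(x,y)<1$ for some $x\in V$ and some $t>0$; otherwise $G$ is stochastically complete. *)

theory Defs
  imports "HOL-Analysis.Analysis"
begin

section \<open>Graphs\<close>

text \<open>
  A graph without loops or multiple edges is a vertex set \<open>V\<close> together with a set \<open>E\<close> of
  two-element subsets of \<open>V\<close>.
\<close>

definition simple_graph :: "'a set \<Rightarrow> 'a set set \<Rightarrow> bool" where
  "simple_graph V E \<longleftrightarrow> (\<forall>e\<in>E. e \<subseteq> V \<and> card e = 2)"

definition adjacent :: "'a set set \<Rightarrow> 'a \<Rightarrow> 'a \<Rightarrow> bool" where
  "adjacent E x y \<longleftrightarrow> {x, y} \<in> E"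

definition neighbors :: "'a set set \<Rightarrow> 'a \<Rightarrow> 'a set" where
  "neighbors E x = {y. adjacent E x y}"

definition valence :: "'a set set \<Rightarrow> 'a \<Rightarrow> nat" where
  "valence E x = card (neighbors E x)"

definition locally_finite_graph :: "'a set \<Rightarrow> 'a set set \<Rightarrow> bool" where
  "locally_finite_graph V E \<longleftrightarrow> (\<forall>x\<in>V. finite (neighbors E x))"

definition connected_graph :: "'a set \<Rightarrow> 'a set set \<Rightarrow> bool" where
  "connected_graph V E \<longleftrightarrow> (\<forall>x\<in>V. \<forall>y\<in>V. (adjacent E)\<^sup>*\<^sup>* x y)"

text \<open>
  The relation power \<open>(adjacent E ^^ n) x y\<close> says that there is a walk with \<open>n\<close> edges from
  \<open>x\<close> to \<open>y\<close>; a walk of minimal length is a path. The value is only meaningful when \<open>x\<close> and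
  \<open>y\<close> are joined by a walk.
\<close>

definition graph_dist :: "'a set set \<Rightarrow> 'a \<Rightarrow> 'a \<Rightarrow> nat" where
  "graph_dist E x y = (LEAST n. (adjacent E ^^ n) x y)"

definition graph_sphere :: "'a set \<Rightarrow> 'a set set \<Rightarrow> 'a \<Rightarrow> nat \<Rightarrow> 'a set" where
  "graph_sphere V E x0 r = {x \<in> V. graph_dist E x x0 = r}"

definition graph_ball :: "'a set \<Rightarrow> 'a set set \<Rightarrow> 'a \<Rightarrow> nat \<Rightarrow> 'a set" where
  "graph_ball V E b r = {x \<in> V. graph_dist E x b \<le> r}"

definition ball_interior :: "'a set \<Rightarrow> 'a set set \<Rightarrow> 'a \<Rightarrow> nat \<Rightarrow> 'a set" where
  "ball_interior V E b r = {x \<in> graph_ball V E b r. neighbors E x \<subseteq> graph_ball V E b r}"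

text \<open>For an infinite, locally finite, connected graph the spheres are finite and nonempty.\<close>

definition max_valence :: "'a set \<Rightarrow> 'a set set \<Rightarrow> 'a \<Rightarrow> nat \<Rightarrow> nat" where
  "max_valence V E x0 r = Max (valence E ` graph_sphere V E x0 r)"

section \<open>Heat kernel\<close>

definition laplacian :: "'a set set \<Rightarrow> ('a \<Rightarrow> real) \<Rightarrow> 'a \<Rightarrow> real" where
  "laplacian E f x = (\<Sum>y\<in>neighbors E x. f x - f y)"

text \<open>
  A function on the ball of radius \<open>r\<close> around \<open>b\<close> that vanishes on its boundary is represented
  by its extension by zero, that is, by a function on all of \<open>'a\<close> that vanishes outside the
  interior of the ball.
\<close>

definition ball_laplacian ::
    "'a set \<Rightarrow> 'a set set \<Rightarrow> 'a \<Rightarrow> nat \<Rightarrow> ('a \<Rightarrow> real) \<Rightarrow> 'a \<Rightarrow> real" where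
  "ball_laplacian V E b r f x = (if x \<in> ball_interior V E b r then laplacian E f x else 0)"

text \<open>
  The exponential series of an operator on real functions. It is used only for an operator on
  the functions vanishing off a fixed finite set, where convergence of the operator exponential
  amounts to pointwise convergence.
\<close>

definition operator_exp :: "(('a \<Rightarrow> real) \<Rightarrow> 'a \<Rightarrow> real) \<Rightarrow> ('a \<Rightarrow> real) \<Rightarrow> 'a \<Rightarrow> real" where
  "operator_exp A f y = (\<Sum>n. (A ^^ n) f y / fact n)"

definition delta :: "'a \<Rightarrow> 'a \<Rightarrow> real" where
  "delta x y = (if y = x then 1 else 0)"

definition ball_heat_kernel ::
    "'a set \<Rightarrow> 'a set set \<Rightarrow> 'a \<Rightarrow> nat \<Rightarrow> real \<Rightarrow> 'a \<Rightarrow> 'a \<Rightarrow> real" where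
  "ball_heat_kernel V E b r t x y =
    (if x \<in> ball_interior V E b r \<and> y \<in> ball_interior V E b r
     then operator_exp (\<lambda>f z. - t * ball_laplacian V E b r f z) (delta x) y
     else 0)"

text \<open>
  The base vertex \<open>b\<close> of the exhaustion is kept as a parameter; for an infinite, locally finite,
  connected graph the limit exists and does not depend on it.
\<close>

definition heat_kernel ::
    "'a set \<Rightarrow> 'a set set \<Rightarrow> 'a \<Rightarrow> real \<Rightarrow> 'a \<Rightarrow> 'a \<Rightarrow> real" where
  "heat_kernel V E b t x y = lim (\<lambda>r. ball_heat_kernel V E b r t x y)"

definition stochastically_incomplete :: "'a set \<Rightarrow> 'a set set \<Rightarrow> 'a \<Rightarrow> bool" where
  "stochastically_incomplete V E b \<longleftrightarrow>
    (\<exists>x\<in>V. \<exists>t>0. (\<Sum>\<^sub>\<infinity>y\<in>V. heat_kernel V E b t x y) < 1)"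

definition stochastically_complete :: "'a set \<Rightarrow> 'a set set \<Rightarrow> 'a \<Rightarrow> bool" where
  "stochastically_complete V E b \<longleftrightarrow> \<not> stochastically_incomplete V E b"

end

theory Submission
  imports Defs
begin

text \<open>
  Stochastic completeness means that the heat flow loses no mass at infinity, and this is forced
  by a barrier \<open>\<gamma> \<ge> 0\<close> that tends to infinity while satisfying \<open>-\<Delta>\<gamma> \<le> 1\<close>: along the random
  walk generated by \<open>-\<Delta>\<close>, the mean of \<open>\<gamma>\<close> grows at speed at most \<open>1\<close>, so the walk started at
  \<open>x\<close> reaches the region \<open>\<gamma> \<ge> R\<close> before time \<open>t\<close> with probability at most \<open>(\<gamma> x + t) / R\<close>. If the
  walk is killed on leaving a finite set \<open>I\<close> outside which \<open>\<gamma> \<ge> R\<close>, then the mass that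
  survives, which is the total mass of the Dirichlet heat kernel of \<open>I\<close>, is at least
  \<open>1 - (\<gamma> x + t) / R\<close> (\<open>sum_dirichlet_heat_kernel_ge\<close>). Since the Dirichlet kernels of the balls
  increase to \<open>p\<^sub>t\<close>, this bounds the mass of \<open>p\<^sub>t\<close> from below, and \<open>R\<close> is arbitrary
  (\<open>stochastically_complete_if_barrier\<close>).

  The barrier is radial: \<open>\<gamma> y\<close> is the sum of \<open>1 / M(i)\<close> over \<open>i < d(y, x\<^sub>0)\<close>. A step from \<open>y\<close> to a
  neighbor raises \<open>\<gamma>\<close> by at most \<open>1 / M(d(y, x\<^sub>0))\<close>, and \<open>y\<close> has at most \<open>M(d(y, x\<^sub>0))\<close> neighbors,
  so \<open>-\<Delta>\<gamma> \<le> 1\<close>. Divergence of the series says precisely that \<open>\<gamma>\<close> tends to infinity.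

  All estimates for the Dirichlet kernels rest on positivity. On a finite set \<open>I\<close> on which the valence
  is at most \<open>c\<close>, the operator \<open>c - \<Delta>\<close> with Dirichlet condition preserves non-negativity, and
  \<open>exp (c t) p\<^sub>t = \<Sum>n. t\<^sup>n / n! (c - \<Delta>)\<^sup>n \<delta>\<^sub>x\<close> (\<open>dirichlet_heat_kernel_sums\<close>). Non-negativity,
  monotonicity in \<open>I\<close>, the upper bound \<open>1\<close> for the mass and the lower bound from the barrier are
  proved for each iterate by induction on \<open>n\<close> and then summed.
\<close>

section \<open>Distances and balls\<close>

lemma adjacent_sym: "adjacent E x y \<longleftrightarrow> adjacent E y x"
  by (simp add: adjacent_def insert_commute)

lemma neighbors_sym: "x \<in> neighbors E y \<longleftrightarrow> y \<in> neighbors E x"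
  by (simp add: neighbors_def adjacent_sym)

lemma neighbors_subset:
  assumes "simple_graph V E"
  shows "neighbors E x \<subseteq> V"
  using assms by (auto simp: simple_graph_def neighbors_def adjacent_def)

lemma walk_of_graph_dist:
  assumes "connected_graph V E" "x \<in> V" "y \<in> V"
  shows "(adjacent E ^^ graph_dist E x y) x y"
proof -
  have "(adjacent E)\<^sup>*\<^sup>* x y"
    using assms by (simp add: connected_graph_def)
  then obtain n where "(adjacent E ^^ n) x y"
    using rtranclp_imp_relpowp by metis
  then show ?thesis
    unfolding graph_dist_def by (rule LeastI)
qed

lemma graph_dist_le: "(adjacent E ^^ n) x y \<Longrightarrow> graph_dist E x y \<le> n"
  unfolding graph_dist_def by (rule Least_le)

lemma graph_dist_neighbor:
  assumes "connected_graph V E" "y \<in> V" "b \<in> V" "z \<in> neighbors E y"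
  shows "graph_dist E z b \<le> Suc (graph_dist E y b)"
proof (rule graph_dist_le)
  have "adjacent E z y"
    using assms(4) by (simp add: neighbors_def adjacent_sym)
  then show "(adjacent E ^^ Suc (graph_dist E y b)) z b"
    using walk_of_graph_dist[OF assms(1-3)] by (rule relpowp_Suc_I2)
qed

text \<open>
  A vertex at distance \<open>n + 1\<close> from the center is a neighbor of one at distance at most \<open>n\<close>, so local
  finiteness passes from one ball to the next.
\<close>

lemma finite_graph_ball:
  assumes "simple_graph V E" "locally_finite_graph V E" "connected_graph V E" "b \<in> V"
  shows "finite (graph_ball V E b n)"
proof (induction n)
  case 0
  have "x = b" if "x \<in> V" "graph_dist E x b = 0" for x
    using walk_of_graph_dist[OF assms(3) that(1) assms(4)] that(2) by simp
  then have "graph_ball V E b 0 \<subseteq> {b}"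
    by (auto simp: graph_ball_def)
  then show ?case
    by (rule finite_subset) simp
next
  case (Suc n)
  have "graph_ball V E b (Suc n) \<subseteq>
      graph_ball V E b n \<union> (\<Union>y\<in>graph_ball V E b n. neighbors E y)"
  proof
    fix x assume x: "x \<in> graph_ball V E b (Suc n)"
    show "x \<in> graph_ball V E b n \<union> (\<Union>y\<in>graph_ball V E b n. neighbors E y)"
    proof (cases "graph_dist E x b = Suc n")
      case True
      then have "(adjacent E ^^ Suc n) x b"
        using x walk_of_graph_dist[OF assms(3) _ assms(4), of x] by (auto simp: graph_ball_def)
      then obtain y where y: "adjacent E x y" "(adjacent E ^^ n) y b"
        by (meson relpowp_Suc_D2)
      then have "y \<in> V"
        using neighbors_subset[OF assms(1), of x] by (auto simp: neighbors_def)
      with y show ?thesis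
        using graph_dist_le[of n E y b] adjacent_sym[of E x y]
        by (auto simp: graph_ball_def neighbors_def)
    qed (use x in \<open>auto simp: graph_ball_def\<close>)
  qed
  moreover have "finite (\<Union>y\<in>graph_ball V E b n. neighbors E y)"
    using Suc assms(2) by (auto simp: locally_finite_graph_def graph_ball_def)
  ultimately show ?case
    using Suc by (meson finite_UnI finite_subset)
qed

lemma ball_interior_subset: "ball_interior V E b r \<subseteq> V"
  by (auto simp: ball_interior_def graph_ball_def)

lemma ball_interior_mono:
  "r \<le> s \<Longrightarrow> ball_interior V E b r \<subseteq> ball_interior V E b s"
  by (fastforce simp: ball_interior_def graph_ball_def)

lemma graph_ball_subset_interior:
  assumes "simple_graph V E" "connected_graph V E" "b \<in> V"
  shows "graph_ball V E b r \<subseteq> ball_interior V E b (Suc r)"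
  using graph_dist_neighbor[OF assms(2) _ assms(3)] neighbors_subset[OF assms(1)]
  by (fastforce simp: ball_interior_def graph_ball_def)

lemma finite_subset_ball_interior:
  assumes "simple_graph V E" "connected_graph V E" "b \<in> V" "finite F" "F \<subseteq> V"
  obtains r where "F \<subseteq> ball_interior V E b r"
proof
  have "F \<subseteq> graph_ball V E b (\<Sum>y\<in>F. graph_dist E y b)"
    using assms(4,5) member_le_sum[of _ F "\<lambda>y. graph_dist E y b"]
    by (auto simp: graph_ball_def)
  then show "F \<subseteq> ball_interior V E b (Suc (\<Sum>y\<in>F. graph_dist E y b))"
    using graph_ball_subset_interior[OF assms(1-3)] by blast
qed

section \<open>The shifted Dirichlet Laplacian on a set of vertices\<close>

text \<open>
  The operator \<open>c - \<Delta>\<close> with Dirichlet condition off \<open>I\<close>. For \<open>c = 0\<close> it generates the heat flow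
  killed off \<open>I\<close>; for \<open>c\<close> at least every valence on \<open>I\<close> all its matrix entries are non-negative.
\<close>

definition shifted_dirichlet :: "'a set set \<Rightarrow> 'a set \<Rightarrow> real \<Rightarrow> ('a \<Rightarrow> real) \<Rightarrow> 'a \<Rightarrow> real" where
  "shifted_dirichlet E I c f y = (if y \<in> I then c * f y - laplacian E f y else 0)"

lemma laplacian_eq:
  "laplacian E f y = real (valence E y) * f y - (\<Sum>z\<in>neighbors E y. f z)"
  by (simp add: laplacian_def valence_def sum_subtractf)

text \<open>
  On \<open>J\<close> the operator is \<open>(c - m(y)) f(y)\<close> plus the sum of \<open>f\<close> over the neighbors of \<open>y\<close>, with
  non-negative coefficients, so it is monotone in \<open>f\<close>; on passing from \<open>I\<close> to \<open>J\<close> zero values are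
  replaced by non-negative ones.
\<close>

lemma shifted_dirichlet_mono:
  assumes "I \<subseteq> J" "\<And>y. y \<in> J \<Longrightarrow> real (valence E y) \<le> c"
    and "\<And>y. 0 \<le> f y" "\<And>y. f y \<le> g y"
  shows "shifted_dirichlet E I c f y \<le> shifted_dirichlet E J c g y"
proof -
  have g: "0 \<le> g z" for z
    using assms(3,4) order_trans by blast
  have "(c - real (valence E y)) * f y + (\<Sum>z\<in>neighbors E y. f z)
      \<le> (c - real (valence E y)) * g y + (\<Sum>z\<in>neighbors E y. g z)"
    "0 \<le> (c - real (valence E y)) * g y + (\<Sum>z\<in>neighbors E y. g z)" if "y \<in> J"
    using assms(2)[OF that] assms(4) g
    by (auto intro!: add_mono mult_left_mono sum_mono add_nonneg_nonneg mult_nonneg_nonneg sum_nonneg)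
  then show ?thesis
    using assms(1) by (auto simp: shifted_dirichlet_def laplacian_eq algebra_simps)
qed

lemma shifted_dirichlet_nonneg:
  assumes "\<And>y. y \<in> I \<Longrightarrow> real (valence E y) \<le> c" "\<And>y. 0 \<le> f y"
  shows "0 \<le> shifted_dirichlet E I c f y"
proof -
  have "shifted_dirichlet E I c (\<lambda>_. 0) y = 0"
    by (simp add: shifted_dirichlet_def laplacian_def)
  then show ?thesis
    using shifted_dirichlet_mono[of I I E c "\<lambda>_. 0" f y] assms by simp
qed

text \<open>
  Green's formula: the adjacency relation is symmetric, and functions vanishing off \<open>I\<close> leave no
  boundary terms. It moves \<open>\<Delta>\<close> from the heat distribution \<open>f\<close> to a test function \<open>\<psi>\<close>.
\<close>

lemma sum_shifted_dirichlet:
  assumes "finite I" "\<And>y. y \<in> I \<Longrightarrow> finite (neighbors E y)"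
    and "\<And>y. y \<notin> I \<Longrightarrow> f y = 0" "\<And>y. y \<notin> I \<Longrightarrow> \<psi> y = 0"
  shows "(\<Sum>y\<in>I. shifted_dirichlet E I c f y * \<psi> y) = (\<Sum>y\<in>I. f y * (c * \<psi> y - laplacian E \<psi> y))"
proof -
  have restrict: "(\<Sum>z\<in>neighbors E y. h z) = (\<Sum>z\<in>I. if z \<in> neighbors E y then h z else 0)"
    if "y \<in> I" "\<And>z. z \<notin> I \<Longrightarrow> h z = 0" for h :: "'a \<Rightarrow> real" and y
  proof -
    have "(\<Sum>z\<in>neighbors E y. h z) = (\<Sum>z\<in>I \<inter> neighbors E y. h z)"
      using assms(2)[OF that(1)] that(2) by (intro sum.mono_neutral_right) auto
    also have "\<dots> = (\<Sum>z\<in>I. if z \<in> neighbors E y then h z else 0)"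
      using assms(1) by (simp add: sum.inter_restrict)
    finally show ?thesis .
  qed
  have "(\<Sum>y\<in>I. \<psi> y * (\<Sum>z\<in>neighbors E y. f z))
      = (\<Sum>y\<in>I. \<Sum>z\<in>I. if z \<in> neighbors E y then \<psi> y * f z else 0)"
    using assms(3) by (auto simp: restrict sum_distrib_left intro!: sum.cong)
  also have "\<dots> = (\<Sum>z\<in>I. \<Sum>y\<in>I. if z \<in> neighbors E y then \<psi> y * f z else 0)"
    by (rule sum.swap)
  also have "\<dots> = (\<Sum>z\<in>I. f z * (\<Sum>y\<in>neighbors E z. \<psi> y))"
    using assms(4) by (auto simp: restrict sum_distrib_left neighbors_sym intro!: sum.cong)
  finally have swap: "(\<Sum>y\<in>I. \<psi> y * (\<Sum>z\<in>neighbors E y. f z))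
      = (\<Sum>z\<in>I. f z * (\<Sum>y\<in>neighbors E z. \<psi> y))" .
  have "(\<Sum>y\<in>I. shifted_dirichlet E I c f y * \<psi> y)
      = (\<Sum>y\<in>I. (c - real (valence E y)) * f y * \<psi> y) + (\<Sum>y\<in>I. \<psi> y * (\<Sum>z\<in>neighbors E y. f z))"
    by (simp add: shifted_dirichlet_def laplacian_eq algebra_simps flip: sum.distrib)
  also have "\<dots> = (\<Sum>y\<in>I. f y * (c * \<psi> y - laplacian E \<psi> y))"
    unfolding swap by (simp add: laplacian_eq algebra_simps flip: sum.distrib)
  finally show ?thesis .
qed

lemma iterate_outside:
  "y \<notin> I \<Longrightarrow> f y = 0 \<Longrightarrow> (shifted_dirichlet E I c ^^ n) f y = 0"
  by (cases n) (simp_all add: shifted_dirichlet_def)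

lemma iterate_nonneg:
  assumes "\<And>y. y \<in> I \<Longrightarrow> real (valence E y) \<le> c" "\<And>y. 0 \<le> f y"
  shows "0 \<le> (shifted_dirichlet E I c ^^ n) f y"
  using assms by (induction n arbitrary: y) (simp_all add: shifted_dirichlet_nonneg)

lemma iterate_mono:
  assumes "I \<subseteq> J" "\<And>y. y \<in> J \<Longrightarrow> real (valence E y) \<le> c" "\<And>y. 0 \<le> f y"
  shows "(shifted_dirichlet E I c ^^ n) f y \<le> (shifted_dirichlet E J c ^^ n) f y"
proof (induction n arbitrary: y)
  case (Suc n)
  have "0 \<le> (shifted_dirichlet E I c ^^ n) f y" for y
    using assms by (intro iterate_nonneg) auto
  then show ?case
    using Suc assms(1,2) by (auto intro: shifted_dirichlet_mono)
qed simp

text \<open>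
  Green's formula with the indicator of \<open>I\<close> as test function: on \<open>I\<close> the indicator attains its
  maximum, so its Laplacian is non-negative there, and one application of the operator multiplies
  the mass by at most \<open>c\<close>.
\<close>

lemma mass_iterate_le:
  assumes "finite I" "\<And>y. y \<in> I \<Longrightarrow> finite (neighbors E y)"
    and "\<And>y. y \<in> I \<Longrightarrow> real (valence E y) \<le> c" "0 \<le> c"
    and "\<And>y. 0 \<le> f y" "\<And>y. y \<notin> I \<Longrightarrow> f y = 0"
  shows "(\<Sum>y\<in>I. (shifted_dirichlet E I c ^^ n) f y) \<le> c ^ n * (\<Sum>y\<in>I. f y)"
proof (induction n)
  case (Suc n)
  let ?g = "(shifted_dirichlet E I c ^^ n) f" and ?one = "indicator I :: 'a \<Rightarrow> real"
  have "(\<Sum>y\<in>I. shifted_dirichlet E I c ?g y) = (\<Sum>y\<in>I. shifted_dirichlet E I c ?g y * ?one y)"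
    by simp
  also have "\<dots> = (\<Sum>y\<in>I. ?g y * (c * ?one y - laplacian E ?one y))"
    using assms by (intro sum_shifted_dirichlet) (auto simp: iterate_outside)
  also have "\<dots> \<le> (\<Sum>y\<in>I. ?g y * c)"
  proof (intro sum_mono mult_left_mono)
    fix y assume "y \<in> I"
    have "0 \<le> laplacian E ?one y"
      unfolding laplacian_def using \<open>y \<in> I\<close> by (intro sum_nonneg) (auto simp: indicator_def)
    then show "c * ?one y - laplacian E ?one y \<le> c"
      using \<open>y \<in> I\<close> by simp
  qed (use assms in \<open>auto intro: iterate_nonneg\<close>)
  also have "\<dots> \<le> c * (c ^ n * (\<Sum>y\<in>I. f y))"
    using mult_left_mono[OF Suc assms(4)] by (simp add: mult.commute[of _ c] flip: sum_distrib_left)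
  finally show ?case
    by (simp add: mult.assoc)
qed simp

text \<open>
  The test function is \<open>\<psi> = 1 - \<gamma> / R\<close> on \<open>I\<close>, extended by zero. At the neighbors of \<open>I\<close> outside
  \<open>I\<close> the bound \<open>\<gamma> \<ge> R\<close> makes this extension at least \<open>1 - \<gamma> / R\<close>, hence
  \<open>\<Delta>\<psi> \<le> -\<Delta>\<gamma> / R \<le> 1 / R\<close> on \<open>I\<close>. By Green's formula each step multiplies the integral of \<open>\<psi>\<close> by at
  least \<open>c\<close>, up to a loss of \<open>1 / R\<close> times the present mass, which is at most \<open>c\<^sup>n\<close>; the losses add up to
  \<open>n c\<^sup>n\<^sup>-\<^sup>1 / R\<close>, the derivative of \<open>c\<^sup>n / R\<close> in \<open>c\<close>.
\<close>

lemma barrier_iterate_ge: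
  fixes \<gamma> :: "'a \<Rightarrow> real"
  assumes "finite I" "\<And>y. y \<in> I \<Longrightarrow> finite (neighbors E y)"
    and "\<And>y. y \<in> I \<Longrightarrow> real (valence E y) \<le> c" "0 \<le> c"
    and "\<And>y. y \<in> I \<Longrightarrow> - laplacian E \<gamma> y \<le> 1"
    and "\<And>y z. y \<in> I \<Longrightarrow> z \<in> neighbors E y \<Longrightarrow> z \<notin> I \<Longrightarrow> R \<le> \<gamma> z" "0 < R" "x \<in> I"
  shows "c ^ n * (1 - \<gamma> x / R) - real n * c ^ (n - 1) / R
    \<le> (\<Sum>y\<in>I. (shifted_dirichlet E I c ^^ n) (delta x) y * (1 - \<gamma> y / R))"
proof (induction n)
  case 0
  show ?case
    using assms(1,8) by (simp add: delta_def if_distrib[of "\<lambda>v. v * _"] cong: if_cong)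
next
  case (Suc n)
  let ?g = "(shifted_dirichlet E I c ^^ n) (delta x)"
  define \<psi> where "\<psi> y = (if y \<in> I then 1 - \<gamma> y / R else 0)" for y
  have g: "0 \<le> ?g y" for y
    using assms(3) by (auto intro!: iterate_nonneg simp: delta_def)
  have lap: "laplacian E \<psi> y \<le> 1 / R" if "y \<in> I" for y
  proof -
    have "laplacian E \<psi> y \<le> (\<Sum>z\<in>neighbors E y. (\<gamma> z - \<gamma> y) / R)"
      unfolding laplacian_def
    proof (rule sum_mono)
      fix z assume z: "z \<in> neighbors E y"
      have "1 - \<gamma> z / R \<le> \<psi> z"
        using assms(6)[OF that z] assms(7) by (auto simp: \<psi>_def)
      then show "\<psi> y - \<psi> z \<le> (\<gamma> z - \<gamma> y) / R"
        using that by (simp add: \<psi>_def diff_divide_distrib)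
    qed
    also have "\<dots> = - laplacian E \<gamma> y / R"
      by (simp add: laplacian_def sum_negf[symmetric] flip: sum_divide_distrib)
    also have "\<dots> \<le> 1 / R"
      using assms(5)[OF that] assms(7) by (intro divide_right_mono) auto
    finally show ?thesis .
  qed
  have mass: "(\<Sum>y\<in>I. ?g y) \<le> c ^ n"
  proof -
    have "(\<Sum>y\<in>I. ?g y) \<le> c ^ n * (\<Sum>y\<in>I. delta x y)"
      using assms by (intro mass_iterate_le) (auto simp: delta_def)
    also have "(\<Sum>y\<in>I. delta x y) = 1"
      using assms(1,8) by (simp add: delta_def)
    finally show ?thesis
      by simp
  qed
  have "c ^ Suc n * (1 - \<gamma> x / R) - real (Suc n) * c ^ n / R
      = c * (c ^ n * (1 - \<gamma> x / R) - real n * c ^ (n - 1) / R) - c ^ n / R"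
    by (cases n) (simp_all add: algebra_simps add_divide_distrib)
  also have "\<dots> \<le> c * (\<Sum>y\<in>I. ?g y * (1 - \<gamma> y / R)) - (\<Sum>y\<in>I. ?g y) / R"
    using mult_left_mono[OF Suc assms(4)] mass assms(7) 
    by (intro diff_mono divide_right_mono) auto
  also have "\<dots> = (\<Sum>y\<in>I. ?g y * (c * \<psi> y - 1 / R))"
    by (simp add: \<psi>_def sum_distrib_left sum_divide_distrib algebra_simps flip: sum_subtractf)
  also have "\<dots> \<le> (\<Sum>y\<in>I. ?g y * (c * \<psi> y - laplacian E \<psi> y))"
    using lap g by (intro sum_mono mult_left_mono) auto
  also have "\<dots> = (\<Sum>y\<in>I. shifted_dirichlet E I c ?g y * \<psi> y)"
    using assms by (intro sum_shifted_dirichlet[symmetric])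
      (auto intro!: iterate_outside simp: delta_def \<psi>_def)
  also have "\<dots> = (\<Sum>y\<in>I. shifted_dirichlet E I c ?g y * (1 - \<gamma> y / R))"
    by (simp add: \<psi>_def)
  finally show ?case
    by simp
qed

section \<open>The Dirichlet heat kernel as a power series with non-negative coefficients\<close>

text \<open>
  The same kernel as for balls, for an arbitrary set \<open>I\<close>, so that kernels of different sets can be
  compared. The minus sign of \<open>exp (-t \<Delta>)\<close> is part of the operator with shift \<open>0\<close>.
\<close>

definition dirichlet_heat_kernel :: "'a set set \<Rightarrow> 'a set \<Rightarrow> real \<Rightarrow> 'a \<Rightarrow> 'a \<Rightarrow> real" where
  "dirichlet_heat_kernel E I t x y =
    (if x \<in> I \<and> y \<in> I
     then operator_exp (\<lambda>f z. t * shifted_dirichlet E I 0 f z) (delta x) y else 0)"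

lemma ball_heat_kernel_eq_dirichlet:
  "ball_heat_kernel V E b r = dirichlet_heat_kernel E (ball_interior V E b r)"
proof -
  have "(\<lambda>f z. - t * ball_laplacian V E b r f z)
      = (\<lambda>f z. t * shifted_dirichlet E (ball_interior V E b r) 0 f z)" for t
    by (auto simp: fun_eq_iff ball_laplacian_def shifted_dirichlet_def)
  then show ?thesis
    by (simp add: fun_eq_iff ball_heat_kernel_def dirichlet_heat_kernel_def)
qed

lemma shifted_dirichlet_sum:
  "shifted_dirichlet E I c (\<lambda>z. \<Sum>k\<in>A. w k * h k z) y
    = (\<Sum>k\<in>A. w k * shifted_dirichlet E I c (h k) y)"
proof -
  have "laplacian E (\<lambda>z. \<Sum>k\<in>A. w k * h k z) y = (\<Sum>k\<in>A. w k * laplacian E (h k) y)"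
    unfolding laplacian_def sum_distrib_left
    by (subst sum.swap) (simp add: sum_subtractf right_diff_distrib)
  then show ?thesis
    by (simp add: shifted_dirichlet_def sum_distrib_left sum_subtractf algebra_simps)
qed

lemma iterate_scaled:
  "((\<lambda>f z. t * shifted_dirichlet E I c f z) ^^ n) f y = t ^ n * (shifted_dirichlet E I c ^^ n) f y"
proof (induction n arbitrary: y)
  case (Suc n)
  then have "((\<lambda>f z. t * shifted_dirichlet E I c f z) ^^ n) f
      = (\<lambda>y. \<Sum>k\<in>{n}. t ^ k * (shifted_dirichlet E I c ^^ k) f y)"
    by auto
  then show ?case
    by (simp only: funpow.simps o_apply shifted_dirichlet_sum) simp
qed simp

text \<open>
  On functions vanishing off \<open>I\<close> the operator is \<open>c\<close> times the identity plus the unshifted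
  operator. These two commute, so the powers expand by the binomial theorem.
\<close>

lemma iterate_binomial:
  assumes "\<And>y. y \<notin> I \<Longrightarrow> f y = 0"
  shows "(shifted_dirichlet E I c ^^ n) f y
    = (\<Sum>k\<le>n. (real (n choose k) * c ^ (n - k)) * (shifted_dirichlet E I 0 ^^ k) f y)"
proof (induction n arbitrary: y)
  case (Suc n)
  let ?a = "\<lambda>k. (shifted_dirichlet E I 0 ^^ k) f"
  let ?w = "\<lambda>n k. real (n choose k) * c ^ (n - k)"
  let ?g = "(shifted_dirichlet E I c ^^ n) f"
  have "shifted_dirichlet E I c ?g y = c * ?g y + shifted_dirichlet E I 0 ?g y"
    using iterate_outside[of y I f n E c] assms by (auto simp: shifted_dirichlet_def)
  also have "shifted_dirichlet E I 0 ?g y = (\<Sum>k\<le>n. ?w n k * ?a (Suc k) y)"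
  proof -
    have "?g = (\<lambda>y. \<Sum>k\<le>n. ?w n k * ?a k y)"
      using Suc by auto
    then show ?thesis
      by (simp only: shifted_dirichlet_sum funpow.simps o_apply)
  qed
  also have "c * ?g y = (\<Sum>k\<le>Suc n. real (n choose k) * c ^ (Suc n - k) * ?a k y)"
  proof -
    have "c * (?w n k * ?a k y) = real (n choose k) * c ^ (Suc n - k) * ?a k y" if "k \<le> n" for k
      using that by (simp add: Suc_diff_le)
    then have "c * ?g y = (\<Sum>k\<le>n. real (n choose k) * c ^ (Suc n - k) * ?a k y)"
      unfolding Suc sum_distrib_left by (intro sum.cong) auto
    then show ?thesis
      by (simp add: binomial_eq_0 del: funpow.simps)
  qed
  also have "\<dots> = c ^ Suc n * ?a 0 y + (\<Sum>k\<le>n. real (n choose Suc k) * c ^ (n - k) * ?a (Suc k) y)"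
    by (subst sum.atMost_Suc_shift) simp
  also have "\<dots> + (\<Sum>k\<le>n. ?w n k * ?a (Suc k) y)
      = c ^ Suc n * ?a 0 y + (\<Sum>k\<le>n. ?w (Suc n) (Suc k) * ?a (Suc k) y)"
    by (simp add: sum.distrib[symmetric] algebra_simps del: funpow.simps)
  also have "\<dots> = (\<Sum>k\<le>Suc n. ?w (Suc n) k * ?a k y)"
    by (subst sum.atMost_Suc_shift) simp
  finally show ?case
    by simp
qed simp

text \<open>
  Unlike the shifted iterates, these take both signs; a crude bound on their size makes the
  exponential series absolutely convergent.
\<close>

lemma iterate_bounded:
  assumes "\<And>y. y \<in> I \<Longrightarrow> real (valence E y) \<le> c" "0 \<le> c" "\<And>y. \<bar>f y\<bar> \<le> 1"
  shows "\<bar>(shifted_dirichlet E I 0 ^^ n) f y\<bar> \<le> (2 * c) ^ n"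
proof (induction n arbitrary: y)
  case (Suc n)
  let ?g = "(shifted_dirichlet E I 0 ^^ n) f"
  have "\<bar>laplacian E ?g y\<bar> \<le> (2 * c) ^ Suc n" if "y \<in> I"
  proof -
    have "\<bar>laplacian E ?g y\<bar> \<le> (\<Sum>z\<in>neighbors E y. \<bar>?g y - ?g z\<bar>)"
      unfolding laplacian_def by (rule sum_abs)
    also have "\<dots> \<le> (\<Sum>z\<in>neighbors E y. 2 * (2 * c) ^ n)"
    proof (rule sum_mono)
      fix z
      show "\<bar>?g y - ?g z\<bar> \<le> 2 * (2 * c) ^ n"
        using Suc[of y] Suc[of z] by linarith
    qed
    also have "\<dots> = real (valence E y) * (2 * (2 * c) ^ n)"
      by (simp add: valence_def)
    also have "\<dots> \<le> c * (2 * (2 * c) ^ n)"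
      using assms(1)[OF that] assms(2) by (intro mult_right_mono) auto
    finally show ?thesis
      by simp
  qed
  then show ?case
    using assms(2) by (simp add: shifted_dirichlet_def[of E I 0 "(shifted_dirichlet E I 0 ^^ n) f"])
qed (use assms in simp)

text \<open>
  The factor \<open>exp (c t)\<close> turns the series of the heat kernel, with terms of both signs, into one with non-negative
  terms, as \<open>exp (c t) exp (-t \<Delta>) = exp (t (c - \<Delta>))\<close>. The proof multiplies the two exponential
  series by Cauchy's product formula and collects terms by the binomial expansion.
\<close>

lemma dirichlet_heat_kernel_sums:
  assumes "\<And>y. y \<in> I \<Longrightarrow> real (valence E y) \<le> c" "0 \<le> c" "x \<in> I"
  shows "(\<lambda>n. t ^ n / fact n * (shifted_dirichlet E I c ^^ n) (delta x) y)
    sums (exp (c * t) * dirichlet_heat_kernel E I t x y)"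
proof (cases "y \<in> I")
  case False
  then have "(shifted_dirichlet E I c ^^ n) (delta x) y = 0" for n
    using assms(3) by (intro iterate_outside) (auto simp: delta_def)
  then show ?thesis
    using False by (simp add: dirichlet_heat_kernel_def)
next
  case True
  let ?a = "\<lambda>k. (shifted_dirichlet E I 0 ^^ k) (delta x) y"
  let ?p = "\<lambda>k. t ^ k / fact k * ?a k" and ?e = "\<lambda>k. (c * t) ^ k / fact k"
  have e: "summable (\<lambda>k. norm (?e k))" "suminf ?e = exp (c * t)"
    using summable_norm_exp[of "c * t"] by (simp_all add: exp_def field_simps)
  have p: "summable (\<lambda>k. norm (?p k))"
  proof (rule summable_comparison_test)
    have "norm (norm (?p k)) \<le> norm ((2 * c * t) ^ k /\<^sub>R fact k)" for k
    proof -
      have "\<bar>?a k\<bar> \<le> (2 * c) ^ k"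
        using assms by (intro iterate_bounded) (auto simp: delta_def)
      then have "\<bar>t\<bar> ^ k / fact k * \<bar>?a k\<bar> \<le> \<bar>t\<bar> ^ k / fact k * (2 * c) ^ k"
        by (intro mult_left_mono) auto
      then show ?thesis
        using assms(2)
        by (simp add: abs_mult power_abs power_mult_distrib field_simps)
    qed
    then show "\<exists>N. \<forall>k\<ge>N. norm (norm (?p k)) \<le> norm ((2 * c * t) ^ k /\<^sub>R fact k)"
      by blast
    show "summable (\<lambda>k. norm ((2 * c * t) ^ k /\<^sub>R fact k))"
      by (rule summable_norm_exp)
  qed
  have "suminf ?p = dirichlet_heat_kernel E I t x y"
    using True assms(3)
    by (simp add: dirichlet_heat_kernel_def operator_exp_def iterate_scaled)
  then have sums: "(\<lambda>n. \<Sum>k\<le>n. ?p k * ?e (n - k))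
      sums (dirichlet_heat_kernel E I t x y * exp (c * t))"
    using Cauchy_product_sums[OF p e(1)] e(2) by simp
  have "(\<Sum>k\<le>n. ?p k * ?e (n - k))
      = t ^ n / fact n * (shifted_dirichlet E I c ^^ n) (delta x) y" for n
  proof -
    have "?p k * ?e (n - k) = t ^ n / fact n * (real (n choose k) * c ^ (n - k) * ?a k)"
      if "k \<le> n" for k
    proof -
      have "t ^ n = t ^ k * t ^ (n - k)"
        using that by (simp flip: power_add)
      then show ?thesis
        using that by (simp add: binomial_fact power_mult_distrib)
    qed
    then have "(\<Sum>k\<le>n. ?p k * ?e (n - k))
        = t ^ n / fact n * (\<Sum>k\<le>n. real (n choose k) * c ^ (n - k) * ?a k)"
      by (simp add: sum_distrib_left)
    also have "(\<Sum>k\<le>n. real (n choose k) * c ^ (n - k) * ?a k)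
        = (shifted_dirichlet E I c ^^ n) (delta x) y"
      using assms(3) by (intro iterate_binomial[symmetric]) (auto simp: delta_def)
    finally show ?thesis .
  qed
  with sums show ?thesis
    by (simp add: mult.commute)
qed

lemma valence_bound:
  assumes "finite I"
  obtains c :: real where "0 \<le> c" "\<And>y. y \<in> I \<Longrightarrow> real (valence E y) \<le> c"
proof
  show "0 \<le> (\<Sum>y\<in>I. real (valence E y))"
    by (simp add: sum_nonneg)
  show "real (valence E y) \<le> (\<Sum>y\<in>I. real (valence E y))" if "y \<in> I" for y
    using assms that by (intro member_le_sum) auto
qed

text \<open>
  The shift \<open>c\<close> must be the same for both sets for their series to be compared term by term; a
  bound for the valences on \<open>J\<close> serves for \<open>I\<close> as well.
\<close>

lemma dirichlet_heat_kernel_mono: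
  assumes "finite J" "I \<subseteq> J" "0 \<le> t" "x \<in> I"
  shows "dirichlet_heat_kernel E I t x y \<le> dirichlet_heat_kernel E J t x y"
proof -
  obtain c where c: "0 \<le> c" "\<And>y. y \<in> J \<Longrightarrow> real (valence E y) \<le> c"
    using valence_bound[OF assms(1)] by blast
  have "exp (c * t) * dirichlet_heat_kernel E I t x y
      \<le> exp (c * t) * dirichlet_heat_kernel E J t x y"
  proof (rule sums_le)
    show "(\<lambda>n. t ^ n / fact n * (shifted_dirichlet E I c ^^ n) (delta x) y)
        sums (exp (c * t) * dirichlet_heat_kernel E I t x y)"
      using c assms by (intro dirichlet_heat_kernel_sums) auto
    show "(\<lambda>n. t ^ n / fact n * (shifted_dirichlet E J c ^^ n) (delta x) y)
        sums (exp (c * t) * dirichlet_heat_kernel E J t x y)"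
      using c assms by (intro dirichlet_heat_kernel_sums) auto
    show "t ^ n / fact n * (shifted_dirichlet E I c ^^ n) (delta x) y
        \<le> t ^ n / fact n * (shifted_dirichlet E J c ^^ n) (delta x) y" for n
      using c assms by (intro mult_left_mono iterate_mono) (auto simp: delta_def)
  qed
  then show ?thesis
    by simp
qed

lemma dirichlet_heat_kernel_nonneg:
  assumes "finite I" "0 \<le> t"
  shows "0 \<le> dirichlet_heat_kernel E I t x y"
proof (cases "x \<in> I")
  case True
  obtain c where c: "0 \<le> c" "\<And>y. y \<in> I \<Longrightarrow> real (valence E y) \<le> c"
    using valence_bound[OF assms(1)] by blast
  have "0 \<le> exp (c * t) * dirichlet_heat_kernel E I t x y"
  proof (rule sums_le)
    show "(\<lambda>_. 0 :: real) sums 0"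
      by simp
    show "(\<lambda>n. t ^ n / fact n * (shifted_dirichlet E I c ^^ n) (delta x) y)
        sums (exp (c * t) * dirichlet_heat_kernel E I t x y)"
      using c True by (intro dirichlet_heat_kernel_sums) auto
    show "0 \<le> t ^ n / fact n * (shifted_dirichlet E I c ^^ n) (delta x) y" for n
      using c assms(2) by (intro mult_nonneg_nonneg iterate_nonneg) (auto simp: delta_def)
  qed
  then show ?thesis
    by (simp add: zero_le_mult_iff)
qed (simp add: dirichlet_heat_kernel_def)

lemma sum_dirichlet_heat_kernel_le_1:
  assumes "finite I" "\<And>y. y \<in> I \<Longrightarrow> finite (neighbors E y)" "0 \<le> t"
  shows "(\<Sum>y\<in>I. dirichlet_heat_kernel E I t x y) \<le> 1"
proof (cases "x \<in> I")
  case True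
  obtain c where c: "0 \<le> c" "\<And>y. y \<in> I \<Longrightarrow> real (valence E y) \<le> c"
    using valence_bound[OF assms(1)] by blast
  have "(\<Sum>y\<in>I. exp (c * t) * dirichlet_heat_kernel E I t x y) \<le> exp (c * t)"
  proof (rule sums_le)
    show "(\<lambda>n. \<Sum>y\<in>I. t ^ n / fact n * (shifted_dirichlet E I c ^^ n) (delta x) y)
        sums (\<Sum>y\<in>I. exp (c * t) * dirichlet_heat_kernel E I t x y)"
      using c True by (intro sums_sum dirichlet_heat_kernel_sums) auto
    show "(\<lambda>n. t ^ n / fact n * c ^ n) sums exp (c * t)"
      using exp_converges[of "c * t"] by (simp add: power_mult_distrib field_simps)
    show "(\<Sum>y\<in>I. t ^ n / fact n * (shifted_dirichlet E I c ^^ n) (delta x) y)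
        \<le> t ^ n / fact n * c ^ n" for n
    proof -
      have "(\<Sum>y\<in>I. (shifted_dirichlet E I c ^^ n) (delta x) y) \<le> c ^ n * (\<Sum>y\<in>I. delta x y)"
        using assms c True by (intro mass_iterate_le) (auto simp: delta_def)
      also have "(\<Sum>y\<in>I. delta x y) = 1"
        using assms(1) True by (simp add: delta_def)
      finally show ?thesis
        using assms(3) unfolding sum_distrib_left[symmetric] by (intro mult_left_mono) auto
    qed
  qed
  then show ?thesis
    by (simp flip: sum_distrib_left)
qed (simp add: dirichlet_heat_kernel_def)

text \<open>
  The terms \<open>c\<^sup>n\<close> and \<open>n c\<^sup>n\<^sup>-\<^sup>1\<close> in the bound for the iterates sum to \<open>exp (c t)\<close> and
  \<open>t exp (c t)\<close>, so the integral of \<open>1 - \<gamma> / R\<close> against the kernel is at least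
  \<open>1 - \<gamma> x / R - t / R\<close>. As \<open>\<gamma> \<ge> 0\<close>, the mass of the kernel is at least this integral.
\<close>

lemma sum_dirichlet_heat_kernel_ge:
  fixes \<gamma> :: "'a \<Rightarrow> real"
  assumes "finite I" "\<And>y. y \<in> I \<Longrightarrow> finite (neighbors E y)" "0 \<le> t"
    and "\<And>y. y \<in> I \<Longrightarrow> 0 \<le> \<gamma> y" "\<And>y. y \<in> I \<Longrightarrow> - laplacian E \<gamma> y \<le> 1"
    and "\<And>y z. y \<in> I \<Longrightarrow> z \<in> neighbors E y \<Longrightarrow> z \<notin> I \<Longrightarrow> R \<le> \<gamma> z" "0 < R" "x \<in> I"
  shows "1 - (\<gamma> x + t) / R \<le> (\<Sum>y\<in>I. dirichlet_heat_kernel E I t x y)"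
proof -
  obtain c where c: "0 \<le> c" "\<And>y. y \<in> I \<Longrightarrow> real (valence E y) \<le> c"
    using valence_bound[OF assms(1)] by blast
  have "exp (c * t) * (1 - \<gamma> x / R) - t * exp (c * t) / R
      \<le> (\<Sum>y\<in>I. exp (c * t) * dirichlet_heat_kernel E I t x y * (1 - \<gamma> y / R))"
  proof (rule sums_le)
    have e: "(\<lambda>n. t ^ n / fact n * c ^ n) sums exp (c * t)"
      using exp_converges[of "c * t"] by (simp add: power_mult_distrib field_simps)
    have "(\<lambda>n. t ^ Suc n / fact (Suc n) * (real (Suc n) * c ^ n)) sums (t * exp (c * t))"
      using sums_mult[OF e, of t] by (simp add: field_simps del: of_nat_Suc)
    then have e': "(\<lambda>n. t ^ n / fact n * (real n * c ^ (n - 1))) sums (t * exp (c * t))"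
      using sums_Suc_iff[of "\<lambda>n. t ^ n / fact n * (real n * c ^ (n - 1))"] by simp
    show "(\<lambda>n. t ^ n / fact n * c ^ n * (1 - \<gamma> x / R) - t ^ n / fact n * (real n * c ^ (n - 1)) / R)
        sums (exp (c * t) * (1 - \<gamma> x / R) - t * exp (c * t) / R)"
      by (intro sums_diff sums_mult2 sums_divide e e')
    show "(\<lambda>n. \<Sum>y\<in>I. t ^ n / fact n * (shifted_dirichlet E I c ^^ n) (delta x) y * (1 - \<gamma> y / R))
        sums (\<Sum>y\<in>I. exp (c * t) * dirichlet_heat_kernel E I t x y * (1 - \<gamma> y / R))"
      using c assms by (intro sums_sum sums_mult2 dirichlet_heat_kernel_sums) auto
    show "t ^ n / fact n * c ^ n * (1 - \<gamma> x / R) - t ^ n / fact n * (real n * c ^ (n - 1)) / R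
        \<le> (\<Sum>y\<in>I. t ^ n / fact n * (shifted_dirichlet E I c ^^ n) (delta x) y * (1 - \<gamma> y / R))" for n
    proof -
      have "t ^ n / fact n * (c ^ n * (1 - \<gamma> x / R) - real n * c ^ (n - 1) / R)
          \<le> t ^ n / fact n * (\<Sum>y\<in>I. (shifted_dirichlet E I c ^^ n) (delta x) y * (1 - \<gamma> y / R))"
        using assms c by (intro mult_left_mono barrier_iterate_ge) auto
      then show ?thesis
        by (simp add: sum_distrib_left right_diff_distrib mult.assoc)
    qed
  qed
  also have "\<dots> \<le> (\<Sum>y\<in>I. exp (c * t) * dirichlet_heat_kernel E I t x y * 1)"
    using assms by (intro sum_mono mult_left_mono mult_nonneg_nonneg dirichlet_heat_kernel_nonneg) auto
  also have "\<dots> = exp (c * t) * (\<Sum>y\<in>I. dirichlet_heat_kernel E I t x y)"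
    by (simp add: sum_distrib_left)
  finally have "exp (c * t) * (1 - (\<gamma> x + t) / R)
      \<le> exp (c * t) * (\<Sum>y\<in>I. dirichlet_heat_kernel E I t x y)"
    by (simp add: algebra_simps add_divide_distrib)
  then show ?thesis
    by simp
qed

section \<open>Exhaustion by balls\<close>

context
  fixes V :: "'a set" and E :: "'a set set" and b :: 'a
  assumes graph: "simple_graph V E" "locally_finite_graph V E" "connected_graph V E" "b \<in> V"
begin

lemma finite_ball_interior: "finite (ball_interior V E b r)"
  using finite_graph_ball[OF graph] by (rule rev_finite_subset) (auto simp: ball_interior_def)

lemma finite_neighbors_ball_interior: "y \<in> ball_interior V E b r \<Longrightarrow> finite (neighbors E y)"
  using graph(2) ball_interior_subset by (fastforce simp: locally_finite_graph_def)

lemma ball_heat_kernel_nonneg: "0 \<le> t \<Longrightarrow> 0 \<le> ball_heat_kernel V E b r t x y"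
  by (simp add: ball_heat_kernel_eq_dirichlet dirichlet_heat_kernel_nonneg finite_ball_interior)

lemma ball_heat_kernel_mono:
  assumes "0 \<le> t" "r \<le> s"
  shows "ball_heat_kernel V E b r t x y \<le> ball_heat_kernel V E b s t x y"
proof (cases "x \<in> ball_interior V E b r")
  case True
  then show ?thesis
    unfolding ball_heat_kernel_eq_dirichlet using assms
    by (intro dirichlet_heat_kernel_mono ball_interior_mono finite_ball_interior)
next
  case False
  then show ?thesis
    using ball_heat_kernel_nonneg[OF assms(1), of s x y] by (simp add: ball_heat_kernel_def)
qed

lemma sum_ball_heat_kernel_le_1:
  assumes "0 \<le> t" "finite F"
  shows "(\<Sum>y\<in>F. ball_heat_kernel V E b r t x y) \<le> 1"
proof -
  let ?I = "ball_interior V E b r"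
  have "(\<Sum>y\<in>F. ball_heat_kernel V E b r t x y) = (\<Sum>y\<in>F \<inter> ?I. ball_heat_kernel V E b r t x y)"
    using assms(2) by (intro sum.mono_neutral_right) (auto simp: ball_heat_kernel_def)
  also have "\<dots> \<le> (\<Sum>y\<in>?I. ball_heat_kernel V E b r t x y)"
    using assms(1) by (intro sum_mono2 finite_ball_interior ball_heat_kernel_nonneg) auto
  also have "\<dots> \<le> 1"
    unfolding ball_heat_kernel_eq_dirichlet using assms(1)
    by (intro sum_dirichlet_heat_kernel_le_1 finite_ball_interior)
      (auto intro: finite_neighbors_ball_interior)
  finally show ?thesis .
qed

text \<open>
  The kernels of the balls increase with the radius and are bounded by their mass, hence by \<open>1\<close>, so
  the limit that defines the heat kernel exists.
\<close>

lemma ball_heat_kernel_tendsto: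
  assumes "0 \<le> t"
  shows "(\<lambda>r. ball_heat_kernel V E b r t x y) \<longlonglongrightarrow> heat_kernel V E b t x y"
proof -
  have "incseq (\<lambda>r. ball_heat_kernel V E b r t x y)"
    using assms by (intro incseq_SucI ball_heat_kernel_mono) simp_all
  moreover have "ball_heat_kernel V E b r t x y \<le> 1" for r
    using sum_ball_heat_kernel_le_1[OF assms, of "{y}" r x] by simp
  ultimately obtain l where "(\<lambda>r. ball_heat_kernel V E b r t x y) \<longlonglongrightarrow> l"
    using incseq_convergent by blast
  then show ?thesis
    by (simp add: heat_kernel_def limI)
qed

lemma ball_heat_kernel_le_heat_kernel:
  assumes "0 \<le> t"
  shows "ball_heat_kernel V E b r t x y \<le> heat_kernel V E b t x y"
  using assms by (intro incseq_le[OF incseq_SucI ball_heat_kernel_tendsto] ball_heat_kernel_mono) auto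

lemma heat_kernel_nonneg: "0 \<le> t \<Longrightarrow> 0 \<le> heat_kernel V E b t x y"
  using ball_heat_kernel_nonneg ball_heat_kernel_le_heat_kernel order_trans by blast

text \<open>
  The infinite sum of a family that is not summable is \<open>0\<close>, so summability has to be shown before
  the sum over a finite set can be compared with it; it follows from the bound \<open>1\<close> for finite sums.
\<close>

lemma sum_ball_heat_kernel_le_infsum:
  assumes "0 \<le> t"
  shows "(\<Sum>y\<in>ball_interior V E b r. ball_heat_kernel V E b r t x y)
    \<le> (\<Sum>\<^sub>\<infinity>y\<in>V. heat_kernel V E b t x y)"
proof -
  have le1: "(\<Sum>y\<in>F. heat_kernel V E b t x y) \<le> 1" if "finite F" for F
    using that assms
    by (intro LIMSEQ_le_const2[OF tendsto_sum[OF ball_heat_kernel_tendsto]])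
      (auto intro: sum_ball_heat_kernel_le_1)
  have summable: "(\<lambda>y. heat_kernel V E b t x y) summable_on V"
    using assms le1 by (intro nonneg_bdd_above_summable_on)
      (auto intro!: bdd_aboveI[of _ 1] heat_kernel_nonneg)
  have "(\<Sum>y\<in>ball_interior V E b r. ball_heat_kernel V E b r t x y)
      \<le> (\<Sum>y\<in>ball_interior V E b r. heat_kernel V E b t x y)"
    using assms by (intro sum_mono ball_heat_kernel_le_heat_kernel)
  also have "\<dots> \<le> (\<Sum>\<^sub>\<infinity>y\<in>V. heat_kernel V E b t x y)"
    using assms summable
    by (intro finite_sum_le_infsum finite_ball_interior ball_interior_subset heat_kernel_nonneg)
  finally show ?thesis .
qed

text \<open>
  A criterion of Khas'minskii type. Balls absorb every finite set, so some ball contains \<open>x\<close> and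
  the sublevel set \<open>\<gamma> < R\<close>; its Dirichlet kernel already has mass at least \<open>1 - (\<gamma> x + t) / R\<close>.
\<close>

lemma stochastically_complete_if_barrier:
  fixes \<gamma> :: "'a \<Rightarrow> real"
  assumes nonneg: "\<And>y. y \<in> V \<Longrightarrow> 0 \<le> \<gamma> y"
    and lap: "\<And>y. y \<in> V \<Longrightarrow> - laplacian E \<gamma> y \<le> 1"
    and proper: "\<And>R. finite {y\<in>V. \<gamma> y < R}"
  shows "stochastically_complete V E b"
  unfolding stochastically_complete_def stochastically_incomplete_def
proof (intro notI, elim bexE exE conjE)
  fix x t assume x: "x \<in> V" and t: "(0::real) < t"
    and "(\<Sum>\<^sub>\<infinity>y\<in>V. heat_kernel V E b t x y) < 1"
  define m where "m = (\<Sum>\<^sub>\<infinity>y\<in>V. heat_kernel V E b t x y)"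
  have less: "m < 1"
    unfolding m_def by fact
  \<comment> \<open>If the mass were \<open>m < 1\<close>, the level \<open>2 R\<close> would give a loss of at most \<open>(1 - m) / 2 < 1 - m\<close>.\<close>
  define R where "R = (\<gamma> x + t) / (1 - m)"
  have R: "0 < R" "(\<gamma> x + t) / R = 1 - m"
    using nonneg[OF x] t less by (auto simp: R_def)
  obtain r where r: "insert x {y\<in>V. \<gamma> y < 2 * R} \<subseteq> ball_interior V E b r"
    using finite_subset_ball_interior[OF graph(1,3,4), of "insert x {y\<in>V. \<gamma> y < 2 * R}"] proper x
    by auto
  have "1 - (\<gamma> x + t) / (2 * R)
      \<le> (\<Sum>y\<in>ball_interior V E b r. dirichlet_heat_kernel E (ball_interior V E b r) t x y)"
  proof (rule sum_dirichlet_heat_kernel_ge)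
    fix y z assume "z \<in> neighbors E y" "z \<notin> ball_interior V E b r"
    then show "2 * R \<le> \<gamma> z"
      using r neighbors_subset[OF graph(1), of y] by force
  qed (use t R r nonneg lap ball_interior_subset[of V E b r] finite_ball_interior
        finite_neighbors_ball_interior in auto)
  also have "\<dots> \<le> m"
    using sum_ball_heat_kernel_le_infsum[of t r x] t by (simp add: ball_heat_kernel_eq_dirichlet m_def)
  finally have "1 - (\<gamma> x + t) / R / 2 \<le> m"
    by (simp add: mult.commute)
  then show False
    using less unfolding R(2) by (simp add: field_simps)
qed

end

section \<open>The radial barrier\<close>

lemma valence_le_max_valence:
  assumes "simple_graph V E" "locally_finite_graph V E" "connected_graph V E" "x0 \<in> V" "y \<in> V"
  shows "valence E y \<le> max_valence V E x0 (graph_dist E y x0)"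
  unfolding max_valence_def
proof (rule Max_ge)
  have "graph_sphere V E x0 (graph_dist E y x0) \<subseteq> graph_ball V E x0 (graph_dist E y x0)"
    by (auto simp: graph_sphere_def graph_ball_def)
  then show "finite (valence E ` graph_sphere V E x0 (graph_dist E y x0))"
    using finite_graph_ball[OF assms(1-4)] finite_subset by blast
qed (use assms(5) in \<open>auto simp: graph_sphere_def\<close>)

theorem theorem3p4:
  fixes V :: "'a set" and E :: "'a set set" and x0 b :: 'a
  assumes "simple_graph V E"
    and "infinite V"
    and "locally_finite_graph V E"
    and "connected_graph V E"
    and "x0 \<in> V"
    and "(\<Sum>r. ennreal (1 / real (max_valence V E x0 r))) = \<infinity>"
    and "b \<in> V"
  shows "stochastically_complete V E b"
proof -
  define M where "M r = real (max_valence V E x0 r)" for r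
  define \<rho> where "\<rho> y = graph_dist E y x0" for y
  define S where "S n = (\<Sum>i<n. 1 / M i)" for n
  have S_mono: "S m \<le> S n" if "m \<le> n" for m n
    unfolding S_def using that by (intro sum_mono2) (auto simp: M_def)
  have unbounded: "\<exists>n. R \<le> S n" for R
  proof (rule ccontr)
    assume "\<not> (\<exists>n. R \<le> S n)"
    then have "(\<Sum>i<n. ennreal (1 / M i)) \<le> ennreal R" for n
      by (auto simp: S_def M_def not_le less_imp_le sum_ennreal intro!: ennreal_leI)
    then have "(\<Sum>i. ennreal (1 / M i)) \<le> ennreal R"
      by (intro suminf_le_const) auto
    then show False
      using assms(6) by (simp add: M_def top_unique)
  qed
  show ?thesis
  proof (rule stochastically_complete_if_barrier[OF assms(1,3,4,7), of "\<lambda>y. S (\<rho> y)"])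
    show "0 \<le> S (\<rho> y)" for y
      by (auto simp: S_def M_def intro: sum_nonneg)
  next
    fix y assume y: "y \<in> V"
    have "- laplacian E (\<lambda>y. S (\<rho> y)) y = (\<Sum>z\<in>neighbors E y. S (\<rho> z) - S (\<rho> y))"
      by (simp add: laplacian_def flip: sum_negf)
    also have "\<dots> \<le> (\<Sum>z\<in>neighbors E y. 1 / M (\<rho> y))"
    proof (rule sum_mono)
      fix z assume "z \<in> neighbors E y"
      then have "\<rho> z \<le> Suc (\<rho> y)"
        unfolding \<rho>_def using assms y by (intro graph_dist_neighbor)
      then show "S (\<rho> z) - S (\<rho> y) \<le> 1 / M (\<rho> y)"
        using S_mono[of "\<rho> z" "Suc (\<rho> y)"] by (simp add: S_def)
    qed
    also have "\<dots> = real (valence E y) / M (\<rho> y)"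
      by (simp add: valence_def)
    also have "\<dots> \<le> 1"
      using valence_le_max_valence[OF assms(1,3,4,5) y]
      by (auto simp: M_def \<rho>_def divide_le_eq_1)
    finally show "- laplacian E (\<lambda>y. S (\<rho> y)) y \<le> 1" .
  next
    fix R
    obtain n where "R \<le> S n"
      using unbounded by blast
    then have "\<rho> y \<le> n" if "S (\<rho> y) < R" for y
      using S_mono[of n "\<rho> y"] that by linarith
    then have "{y \<in> V. S (\<rho> y) < R} \<subseteq> graph_ball V E x0 n"
      by (auto simp: graph_ball_def \<rho>_def)
    then show "finite {y \<in> V. S (\<rho> y) < R}"
      using finite_graph_ball[OF assms(1,3,4,5)] finite_subset by blast
  qed
qed

end
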